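(* Let $K$ be a field of characteristic different from $2$ and let $n = 2k$ where $k \geq 1$ is odd. Let $L$ be any cyclic Galois extension of $K$ of degree $n$ with Galois group $G = \langle \sigma \rangle$. Then there are $K$-subspaces $\mathcal{U}_1, \mathcal{V}_1$ of $A^1 = A^{\sigma}$ such that $$A^1 = \mathcal{U}_1 \oplus \mathcal{V}_1,$$ where $\mathcal{U}_1$ is an $n$-subspace of dimension $k$ and $\mathcal{V}_1$ is an $(n-2)$-subspace of dimension $k$ (dimensions over $K$).
   Context: For a finite Galois extension $L/K$, $\mathrm{Alt}_K(L)$ denotes the $K$-space of alternating $K$-bilinear forms (skew-forms) $L \times L \to K$, and $\mathrm{Tr}^L_K(a) = \sum_{\theta \in \mathrm{Gal}(L/K)} \theta(a)$. For $\tau \in \mathrm{Gal}(L/K)$ and $b \in L$ define the skew-form $f_{b,\tau}(x,y) = \mathrm{Tr}^L_K\big(b(x\tau(y) - \tau(x)y)\big)$ for $x,y \in L$, and the subspace $A^{\tau} = \{ f_{b,\tau} : b \in L\}$ of $\mathrm{Alt}_K(L)$. If $\mathrm{Gal}(L/K) = \langle \sigma\rangle$ is cyclic, write $A^i = A^{\sigma^i}$. An $r$-subspace of $\mathrm{Alt}_K(L)$ is a $K$-subspace all of whose nonzero skew-forms have rank $r$.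
   Formalization: The claim that V_1 has dimension k is made only for k > 1: for k = 1 (n = 2) an (n-2)-subspace is a 0-subspace, hence zero, so it cannot have dimension 1. All other claims are made for k = 1 too. *)

theory Defs
  imports
    Complex_Main
    "HOL-Algebra.Generated_Groups"
    "HOL-Library.Function_Algebras"
begin

text \<open>
  A field extension is a ring homomorphism \<open>\<iota>\<close> from the field \<open>'k\<close> to the field \<open>'l\<close>
  (injective, as any ring homomorphism between fields); \<open>K\<close> is identified with
  \<open>range \<iota>\<close>.
\<close>

locale field_extension =
  fixes \<iota> :: "'k::field \<Rightarrow> 'l::field"
  assumes emb_one: "\<iota> 1 = 1"
    and emb_add: "\<iota> (a + b) = \<iota> a + \<iota> b"
    and emb_mult: "\<iota> (a * b) = \<iota> a * \<iota> b"

definition ext_scale :: "('k::field \<Rightarrow> 'l::field) \<Rightarrow> 'k \<Rightarrow> 'l \<Rightarrow> 'l" where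
  "ext_scale \<iota> c x = \<iota> c * x"

definition galois_group :: "('k::field \<Rightarrow> 'l::field) \<Rightarrow> ('l \<Rightarrow> 'l) monoid" where
  "galois_group \<iota> =
     \<lparr>carrier = {\<theta>. bij \<theta> \<and> (\<forall>x y. \<theta> (x + y) = \<theta> x + \<theta> y) \<and>
                    (\<forall>x y. \<theta> (x * y) = \<theta> x * \<theta> y) \<and> (\<forall>c. \<theta> (\<iota> c) = \<iota> c)},
      monoid.mult = (\<circ>), one = id\<rparr>"

text \<open>
  Finiteness of the degree is an explicit axiom because \<open>vector_space.dim\<close> is \<open>0\<close> on
  infinite-dimensional spaces. The last axiom says that the fixed field of the Galois group
  is \<open>K\<close>.
\<close>

locale finite_galois_extension = field_extension \<iota>
  for \<iota> :: "'k::field \<Rightarrow> 'l::field" +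
  assumes finite_degree: "\<exists>B. finite B \<and> module.span (ext_scale \<iota>) B = UNIV"
    and fixed_field: "{x. \<forall>\<theta> \<in> carrier (galois_group \<iota>). \<theta> x = x} = range \<iota>"

definition ext_degree :: "('k::field \<Rightarrow> 'l::field) \<Rightarrow> nat" where
  "ext_degree \<iota> = vector_space.dim (ext_scale \<iota>) UNIV"

text \<open>
  The sum over the Galois group is an element of \<open>range \<iota>\<close>; \<open>inv \<iota>\<close> turns it into an
  element of \<open>K\<close>.
\<close>

definition ext_trace :: "('k::field \<Rightarrow> 'l::field) \<Rightarrow> 'l \<Rightarrow> 'k" where
  "ext_trace \<iota> a = inv_into UNIV \<iota> (\<Sum>\<theta> \<in> carrier (galois_group \<iota>). \<theta> a)"

definition form_scale :: "'k::field \<Rightarrow> ('l \<Rightarrow> 'l \<Rightarrow> 'k) \<Rightarrow> 'l \<Rightarrow> 'l \<Rightarrow> 'k" where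
  "form_scale c f = (\<lambda>x y. c * f x y)"

definition Alt :: "('k::field \<Rightarrow> 'l::field) \<Rightarrow> ('l \<Rightarrow> 'l \<Rightarrow> 'k) set" where
  "Alt \<iota> = {f. (\<forall>x. Vector_Spaces.linear (ext_scale \<iota>) (*) (\<lambda>y. f x y)) \<and>
              (\<forall>y. Vector_Spaces.linear (ext_scale \<iota>) (*) (\<lambda>x. f x y)) \<and>
              (\<forall>x. f x x = 0)}"

definition form_radical :: "('l \<Rightarrow> 'l \<Rightarrow> 'k::field) \<Rightarrow> 'l set" where
  "form_radical f = {x. \<forall>y. f x y = 0}"

definition form_rank :: "('k::field \<Rightarrow> 'l::field) \<Rightarrow> ('l \<Rightarrow> 'l \<Rightarrow> 'k) \<Rightarrow> nat" where
  "form_rank \<iota> f = ext_degree \<iota> - vector_space.dim (ext_scale \<iota>) (form_radical f)"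

text \<open>
  The only \<open>0\<close>-subspace is the zero space, because a form whose radical is all of
  \<open>'l\<close> vanishes. So in degree \<open>2\<close> an \<open>(n - 2)\<close>-subspace has dimension \<open>0\<close>.
\<close>

definition r_subspace :: "('k::field \<Rightarrow> 'l::field) \<Rightarrow> nat \<Rightarrow> ('l \<Rightarrow> 'l \<Rightarrow> 'k) set \<Rightarrow> bool" where
  "r_subspace \<iota> r U \<longleftrightarrow>
     U \<subseteq> Alt \<iota> \<and> module.subspace form_scale U \<and> (\<forall>f \<in> U. f \<noteq> 0 \<longrightarrow> form_rank \<iota> f = r)"

definition skew_form :: "('k::field \<Rightarrow> 'l::field) \<Rightarrow> 'l \<Rightarrow> ('l \<Rightarrow> 'l) \<Rightarrow> 'l \<Rightarrow> 'l \<Rightarrow> 'k" where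
  "skew_form \<iota> b \<tau> = (\<lambda>x y. ext_trace \<iota> (b * (x * \<tau> y - \<tau> x * y)))"

definition skew_space :: "('k::field \<Rightarrow> 'l::field) \<Rightarrow> ('l \<Rightarrow> 'l) \<Rightarrow> ('l \<Rightarrow> 'l \<Rightarrow> 'k) set" where
  "skew_space \<iota> \<tau> = range (\<lambda>b. skew_form \<iota> b \<tau>)"

lemma vector_space_form_scale: "vector_space (form_scale :: 'k::field \<Rightarrow> ('l \<Rightarrow> 'l \<Rightarrow> 'k) \<Rightarrow> _)"
  by unfold_locales (auto simp: form_scale_def fun_eq_iff algebra_simps)

context field_extension
begin

lemma vector_space_ext_scale: "vector_space (ext_scale \<iota>)"
  by unfold_locales (auto simp: ext_scale_def algebra_simps emb_one emb_add emb_mult)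

lemma emb_zero: "\<iota> 0 = 0"
  using emb_add[of 0 0] by (metis add.right_neutral add_left_cancel)

lemma inj_emb: "inj \<iota>"
proof (rule injI)
  fix a b assume eq: "\<iota> a = \<iota> b"
  have "\<iota> (a - b) = 0"
    using emb_add[of "a - b" b] eq by simp
  then have "\<iota> ((a - b) * inverse (a - b)) = 0"
    by (simp add: emb_mult)
  then show "a = b"
    using emb_one by (cases "a - b = 0") auto
qed

lemma group_galois_group: "group (galois_group \<iota>)"
proof (rule groupI)
  fix \<theta> assume th: "\<theta> \<in> carrier (galois_group \<iota>)"
  then have bij: "bij \<theta>" and add: "\<And>x y. \<theta> (x + y) = \<theta> x + \<theta> y"
    and mult: "\<And>x y. \<theta> (x * y) = \<theta> x * \<theta> y" and fixes_emb: "\<And>c. \<theta> (\<iota> c) = \<iota> c"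
    by (auto simp: galois_group_def)
  have r: "\<theta> (inv_into UNIV \<theta> x) = x" for x
    using bij by (simp add: bij_is_surj surj_f_inv_f)
  have l: "inv_into UNIV \<theta> x = y \<longleftrightarrow> x = \<theta> y" for x y
    using bij by (metis bij_inv_eq_iff)
  have "inv_into UNIV \<theta> \<in> carrier (galois_group \<iota>)"
    unfolding galois_group_def using bij by (auto simp: bij_imp_bij_inv l add mult fixes_emb r)
  moreover have "inv_into UNIV \<theta> \<otimes>\<^bsub>galois_group \<iota>\<^esub> \<theta> = \<one>\<^bsub>galois_group \<iota>\<^esub>"
    using bij by (auto simp: galois_group_def bij_is_inj)
  ultimately show "\<exists>y \<in> carrier (galois_group \<iota>). y \<otimes>\<^bsub>galois_group \<iota>\<^esub> \<theta> = \<one>\<^bsub>galois_group \<iota>\<^esub>"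
    by blast
qed (auto simp: galois_group_def bij_comp comp_assoc)

end

context finite_galois_extension
begin

lemma emb_ext_trace: "\<iota> (ext_trace \<iota> a) = (\<Sum>\<theta> \<in> carrier (galois_group \<iota>). \<theta> a)"
proof -
  let ?G = "galois_group \<iota>"
  interpret G: group ?G by (rule group_galois_group)
  have "\<tau> (\<Sum>\<theta> \<in> carrier ?G. \<theta> a) = (\<Sum>\<theta> \<in> carrier ?G. \<theta> a)"
    if t: "\<tau> \<in> carrier ?G" for \<tau>
  proof -
    have add: "\<tau> (x + y) = \<tau> x + \<tau> y" for x y
      using t by (simp add: galois_group_def)
    have zero: "\<tau> 0 = 0"
      using add[of 0 0] by (metis add.right_neutral add_left_cancel)
    have "\<tau> (\<Sum>\<theta> \<in> A. \<theta> a) = (\<Sum>\<theta> \<in> A. \<tau> (\<theta> a))" for A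
      by (induction A rule: infinite_finite_induct) (auto simp: zero add)
    moreover have "bij_betw (\<lambda>\<theta>. \<tau> \<circ> \<theta>) (carrier ?G) (carrier ?G)"
      using t G.inj_on_cmult[of \<tau>] G.surj_const_mult[of \<tau>]
      by (simp add: bij_betw_def galois_group_def)
    then have "(\<Sum>\<theta> \<in> carrier ?G. (\<tau> \<circ> \<theta>) a) = (\<Sum>\<theta> \<in> carrier ?G. \<theta> a)"
      by (rule sum.reindex_bij_betw)
    ultimately show ?thesis by simp
  qed
  then have "(\<Sum>\<theta> \<in> carrier ?G. \<theta> a) \<in> range \<iota>"
    using fixed_field by blast
  then show ?thesis
    unfolding ext_trace_def by (rule f_inv_into_f)
qed

end

end

theory Submission
  imports Defs
begin

text \<open>
  Write \<open>f\<^sub>b\<close> for the skew-form \<open>f\<^bsub>b,\<sigma>\<^esub>\<close>, and \<open>F\<close> for the fixed field of \<open>\<sigma>\<^sup>2\<close>. Invariance of the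
  trace under \<open>\<sigma>\<close> gives \<open>f\<^sub>b(x, y) = Tr((b x - \<sigma>(b) \<sigma>\<^sup>2(x)) \<sigma>(y))\<close>. The trace form is
  nondegenerate, so the radical of \<open>f\<^sub>b\<close> is the solution set of the twisted equation
  \<open>b x = \<sigma>(b) \<sigma>\<^sup>2(x)\<close> (lemma \<open>radical_skew_form\<close>). When \<open>b \<noteq> 0\<close>, the quotient of two nonzero
  solutions is fixed by \<open>\<sigma>\<^sup>2\<close>: the radical is \<open>0\<close> or a line over \<open>F\<close>, which is quadratic over
  \<open>K\<close>. Thus the rank of \<open>f\<^sub>b\<close> is \<open>n\<close> or \<open>n - 2\<close>, according to the solvability of this equation.

  The involution \<open>\<sigma>\<^sup>k\<close> splits \<open>L\<close> into its eigenspaces for \<open>- 1\<close> and \<open>1\<close>, both of dimension \<open>k\<close>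
  because \<open>2 \<noteq> 0\<close>; \<open>\<U>\<close> and \<open>\<V>\<close> are their images under \<open>b \<mapsto> f\<^sub>b\<close>. Let \<open>N\<close> be the norm from \<open>L\<close>
  to \<open>F\<close>.

  \<^item> If \<open>\<sigma>\<^sup>k(b) = - b \<noteq> 0\<close>, then \<open>\<sigma>\<^sup>k(N(b)) = N(- b) = - N(b)\<close> since \<open>k\<close> is odd, so
    \<open>N(b)\<close> is not fixed by \<open>\<sigma>\<close>. A nonzero solution \<open>x\<close> would give
    \<open>N(b) N(x) = \<sigma>(N(b)) N(x)\<close>, which is impossible: the radical is \<open>0\<close>
    (lemma \<open>radical_minus_eigenspace\<close>).
  \<^item> If \<open>\<sigma>\<^sup>k(b) = b \<noteq> 0\<close>, put \<open>m = (k + 1) / 2\<close>. Then \<open>\<sigma>(b) = \<sigma>\<^bsup>2m\<^esup>(b)\<close>, so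
    \<open>b / \<sigma>(b) = b / (\<sigma>\<^sup>2)\<^sup>m(b)\<close> telescopes and the inverse of \<open>b \<sigma>\<^sup>2(b) \<dots> \<sigma>\<^bsup>2(m-1)\<^esup>(b)\<close> is an
    explicit solution (lemma \<open>dim_radical_plus_eigenspace\<close>), which replaces an appeal to
    Hilbert's theorem 90.

  All the Galois theory is drawn from one fact, the linear counterpart of the bound on the number
  of roots of a polynomial: a nonzero operator \<open>\<Sum>\<^bsub>i\<le>m\<^esub> a\<^sub>i \<sigma>\<^sup>i\<close> with coefficients in \<open>L\<close> has a kernel
  of dimension at most \<open>m\<close> over \<open>K\<close> (lemma \<open>dim_kernel_skew_poly_le\<close>). It yields that \<open>\<sigma>\<close>
  has order \<open>n\<close>, that the trace form is nondegenerate, that eigenspaces of \<open>\<sigma>\<^sup>k\<close> have dimension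
  at most \<open>k\<close>, and that radicals of nonzero \<open>b\<close> have dimension at most \<open>2\<close>.
\<close>

section \<open>Powers of the generator\<close>

locale cyclic_extension = finite_galois_extension \<iota>
  for \<iota> :: "'k::field \<Rightarrow> 'l::field" +
  fixes \<sigma> :: "'l \<Rightarrow> 'l"
  assumes generator_in_group: "\<sigma> \<in> carrier (galois_group \<iota>)"
    and group_generated: "carrier (galois_group \<iota>) = generate (galois_group \<iota>) {\<sigma>}"
begin

lemma sigma_add: "\<sigma> (x + y) = \<sigma> x + \<sigma> y"
  and sigma_mult: "\<sigma> (x * y) = \<sigma> x * \<sigma> y"
  and sigma_emb: "\<sigma> (\<iota> c) = \<iota> c"
  and sigma_bij: "bij \<sigma>"
  using generator_in_group by (simp_all add: galois_group_def)

lemma funpow_add: "(\<sigma> ^^ i) (x + y) = (\<sigma> ^^ i) x + (\<sigma> ^^ i) y"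
  by (induction i) (simp_all add: sigma_add)

lemma funpow_times: "(\<sigma> ^^ i) (x * y) = (\<sigma> ^^ i) x * (\<sigma> ^^ i) y"
  by (induction i) (simp_all add: sigma_mult)

lemma funpow_emb: "(\<sigma> ^^ i) (\<iota> c) = \<iota> c"
  by (induction i) (simp_all add: sigma_emb)

lemma funpow_zero: "(\<sigma> ^^ i) 0 = 0"
  using funpow_emb[of i 0] by (simp add: emb_zero)

lemma funpow_one: "(\<sigma> ^^ i) 1 = 1"
  using funpow_emb[of i 1] by (simp add: emb_one)

lemma funpow_minus: "(\<sigma> ^^ i) (- x) = - (\<sigma> ^^ i) x"
  using funpow_add[of i x "- x"] by (simp add: funpow_zero eq_neg_iff_add_eq_0 add.commute)

lemma funpow_diff: "(\<sigma> ^^ i) (x - y) = (\<sigma> ^^ i) x - (\<sigma> ^^ i) y"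
  using funpow_add[of i x "- y"] by (simp add: funpow_minus)

lemma funpow_eq_0_iff: "(\<sigma> ^^ i) x = 0 \<longleftrightarrow> x = 0"
proof -
  have "inj (\<sigma> ^^ i)"
    using sigma_bij by (simp add: bij_is_inj inj_fn)
  then show ?thesis
    by (metis funpow_zero injD)
qed

lemma funpow_divide: "(\<sigma> ^^ i) (x / y) = (\<sigma> ^^ i) x / (\<sigma> ^^ i) y"
proof (cases "y = 0")
  case False
  then have "(\<sigma> ^^ i) (x / y) * (\<sigma> ^^ i) y = (\<sigma> ^^ i) x"
    by (simp flip: funpow_times)
  with False show ?thesis
    by (simp add: funpow_eq_0_iff eq_divide_eq)
qed (simp add: funpow_zero)

lemma funpow_comp: "(\<sigma> ^^ i) ((\<sigma> ^^ j) x) = (\<sigma> ^^ (i + j)) x"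
  by (simp add: Nat.funpow_add)

lemmas sigma_zero = funpow_zero[of 1, simplified]
  and sigma_one = funpow_one[of 1, simplified]
  and sigma_divide = funpow_divide[of 1, simplified]
  and sigma_eq_0_iff = funpow_eq_0_iff[of 1, simplified]

lemma funpow_in_group: "\<sigma> ^^ i \<in> carrier (galois_group \<iota>)"
  using sigma_bij
  by (simp add: galois_group_def funpow_add funpow_times funpow_emb bij_fn)

text \<open>
  An element fixed by the generator is fixed by the whole group. This is the only way in which
  the Galois property enters the kernel bound below.
\<close>

lemma fixed_by_sigma:
  assumes "\<sigma> x = x"
  shows "x \<in> range \<iota>"
proof -
  interpret G: group "galois_group \<iota>" by (rule group_galois_group)
  have "\<theta> x = x" if "\<theta> \<in> generate (galois_group \<iota>) {\<sigma>}" for \<theta>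
    using that
  proof (induction rule: generate.induct)
    case (inv h)
    then have "inv\<^bsub>galois_group \<iota>\<^esub> \<sigma> \<circ> \<sigma> = id"
      using G.l_inv[OF generator_in_group] by (simp add: galois_group_def)
    then show ?case
      using assms inv by (metis comp_apply id_apply singletonD)
  qed (use assms in \<open>simp_all add: galois_group_def\<close>)
  then show ?thesis
    using fixed_field group_generated by blast
qed

sublocale vector_space "ext_scale \<iota>"
  by (rule vector_space_ext_scale)

sublocale finite_dimensional_vector_space "ext_scale \<iota>" "extend_basis {}"
proof unfold_locales
  obtain B where "finite B" "span B = UNIV"
    using finite_degree by blast
  then show "finite (extend_basis {})"
    using independent_span_bound[of B "extend_basis {}"] independent_extend_basis[of "{}"]
    by (simp add: independent_empty)
qed (use independent_extend_basis[of "{}"] in \<open>simp_all add: independent_empty\<close>)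

lemma degree_eq_dim: "ext_degree \<iota> = dim UNIV"
  by (simp add: ext_degree_def)

lemma degree_pos: "ext_degree \<iota> > 0"
proof -
  have "dim {1} \<le> ext_degree \<iota>"
    unfolding degree_eq_dim by (rule dim_subset) simp
  then show ?thesis by simp
qed

section \<open>Operators that are polynomials in the generator\<close>

definition skew_poly :: "nat \<Rightarrow> (nat \<Rightarrow> 'l) \<Rightarrow> 'l \<Rightarrow> 'l" where
  "skew_poly m a x = (\<Sum>i\<le>m. a i * (\<sigma> ^^ i) x)"

lemma subspace_kernel_skew_poly: "subspace {x. skew_poly m a x = 0}"
proof (rule subspaceI)
  fix c x
  assume "x \<in> {x. skew_poly m a x = 0}"
  moreover have "skew_poly m a (ext_scale \<iota> c x) = \<iota> c * skew_poly m a x"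
    by (simp add: skew_poly_def ext_scale_def funpow_times funpow_emb sum_distrib_left ac_simps)
  ultimately show "ext_scale \<iota> c x \<in> {x. skew_poly m a x = 0}"
    by simp
qed (auto simp: skew_poly_def funpow_zero funpow_add distrib_left sum.distrib)

text \<open>
  The analogue of dividing a polynomial by a linear factor at a root. For a root \<open>x\<^sub>0 \<noteq> 0\<close>, the
  operator \<open>z \<mapsto> P(x\<^sub>0 z)\<close> kills \<open>1\<close>, so its coefficients sum to \<open>0\<close> and it equals \<open>Q (\<sigma> - 1)\<close>
  with \<open>Q\<close> of degree one less. The kernel of \<open>x \<mapsto> \<sigma>(x / x\<^sub>0) - x / x\<^sub>0\<close> is the line \<open>K x\<^sub>0\<close>, so this
  map sends the other independent roots of \<open>P\<close> to independent roots of \<open>Q\<close>.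
\<close>

lemma skew_poly_zero_coeffs:
  assumes "independent B" "m < card B" "\<And>x. x \<in> B \<Longrightarrow> skew_poly m a x = 0" "i \<le> m"
  shows "a i = 0"
  using assms
proof (induction m arbitrary: B a i)
  case 0
  have "finite B"
    by (rule ccontr) (use 0 in simp)
  have "\<not> B \<subseteq> {0}"
    using 0 dependent_zero[of B] by (auto simp: subset_singleton_iff)
  then obtain x where "x \<in> B" "x \<noteq> 0" by blast
  with 0 show ?case by (auto simp: skew_poly_def)
next
  case (Suc m)
  have fin: "finite B"
    by (rule ccontr) (use Suc.prems in simp)
  obtain x0 where x0: "x0 \<in> B"
    using Suc.prems(2) by fastforce
  have x0_ne: "x0 \<noteq> 0"
    using x0 Suc.prems(1) dependent_zero[of B] by blast
  define f where "f x = \<sigma> (x / x0) - x / x0" for x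
  define c where "c j = a j * (\<sigma> ^^ j) x0" for j
  define b where "b j = (\<Sum>l=Suc j..Suc m. c l)" for j
  have lin: "Vector_Spaces.linear (ext_scale \<iota>) (ext_scale \<iota>) f"
    by unfold_locales
      (auto simp: f_def ext_scale_def sigma_mult sigma_divide sigma_emb sigma_add
          add_divide_distrib algebra_simps)
  then interpret f: Vector_Spaces.linear "ext_scale \<iota>" "ext_scale \<iota>" f .
  have ind: "independent (B - {x0})"
    using Suc.prems(1) independent_mono by blast
  have inj: "inj_on f (span (B - {x0}))"
    unfolding f.inj_on_iff_eq_0[OF subspace_span]
  proof (intro ballI impI)
    fix x assume x: "x \<in> span (B - {x0})" "f x = 0"
    then obtain t where "x / x0 = \<iota> t"
      using fixed_by_sigma[of "x / x0"] by (auto simp: f_def)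
    then have xt: "x = ext_scale \<iota> t x0"
      using x0_ne by (simp add: ext_scale_def divide_eq_eq)
    have "t = 0"
    proof (rule ccontr)
      assume "t \<noteq> 0"
      then have "x0 = ext_scale \<iota> (1 / t) x"
        using xt by (simp add: scale_scale)
      then have "x0 \<in> span (B - {x0})"
        using x(1) span_scale by metis
      then show False
        using Suc.prems(1) x0 by (auto simp: dependent_def)
    qed
    then show "x = 0"
      using xt by simp
  qed
  \<comment> \<open>This says that \<open>z \<mapsto> P (x\<^sub>0 * z)\<close>, whose coefficients are the \<open>c j\<close>, kills \<open>1\<close>.\<close>
  have sum_c: "(\<Sum>j\<le>Suc m. c j) = 0"
    using Suc.prems(3)[OF x0] by (simp add: skew_poly_def c_def)
  \<comment> \<open>Summation by parts performs the division by \<open>\<sigma> - 1\<close>; the quotient has coefficients \<open>b j\<close>.\<close>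
  have abel: "(\<Sum>j\<le>p. (\<Sum>l=Suc j..Suc p. d l) * (g (Suc j) - g j)) = (\<Sum>l\<le>Suc p. d l * (g l - g 0))"
    for p and d g :: "nat \<Rightarrow> 'l"
  proof (induction p)
    case (Suc p)
    have tele: "(\<Sum>j\<le>p. g (Suc j) - g j) = g (Suc p) - g 0"
      by (induction p) simp_all
    have "(\<Sum>j\<le>p. (\<Sum>l=Suc j..Suc (Suc p). d l) * (g (Suc j) - g j)) =
        (\<Sum>j\<le>p. (\<Sum>l=Suc j..Suc p. d l) * (g (Suc j) - g j)
           + d (Suc (Suc p)) * (g (Suc j) - g j))"
      by (rule sum.cong) (simp_all add: distrib_right)
    also have "\<dots> = (\<Sum>l\<le>Suc p. d l * (g l - g 0)) + d (Suc (Suc p)) * (g (Suc p) - g 0)"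
      by (simp only: sum.distrib Suc.IH flip: sum_distrib_left tele)
    finally show ?case
      by (simp add: algebra_simps)
  qed simp
  have kills: "skew_poly m b (f x) = 0" if "x \<in> B" for x
  proof -
    define z where "z = x / x0"
    have "skew_poly m b (f x) = (\<Sum>j\<le>m. b j * ((\<sigma> ^^ Suc j) z - (\<sigma> ^^ j) z))"
      unfolding skew_poly_def f_def z_def[symmetric] by (simp add: funpow_diff funpow_swap1)
    also have "\<dots> = (\<Sum>l\<le>Suc m. c l * ((\<sigma> ^^ l) z - (\<sigma> ^^ 0) z))"
      unfolding b_def by (rule abel)
    also have "\<dots> = (\<Sum>l\<le>Suc m. c l * (\<sigma> ^^ l) z) - (\<Sum>l\<le>Suc m. c l) * z"
      by (simp only: right_diff_distrib sum_subtractf sum_distrib_right funpow_0)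
    also have "(\<Sum>l\<le>Suc m. c l * (\<sigma> ^^ l) z) = skew_poly (Suc m) a x"
      unfolding skew_poly_def c_def z_def
      by (rule sum.cong) (simp_all add: funpow_divide funpow_eq_0_iff x0_ne)
    finally show ?thesis
      using Suc.prems(3)[OF that] sum_c by simp
  qed
  have "card (f ` (B - {x0})) = card (B - {x0})"
    by (rule card_image[OF inj_on_subset[OF inj span_superset]])
  then have card: "m < card (f ` (B - {x0}))"
    using Suc.prems(2) fin x0 by simp
  have b0: "b j = 0" if "j \<le> m" for j
    by (rule Suc.IH[OF f.independent_injective_image[OF ind inj] card _ that, of b])
      (auto simp: kills)
  have c0: "c (Suc j) = 0" if "j \<le> m" for j
  proof -
    have "b j = c (Suc j) + (if j < m then b (Suc j) else 0)"
      using that unfolding b_def by (auto simp: sum.atLeast_Suc_atMost)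
    then show ?thesis
      using b0 that by (auto split: if_splits)
  qed
  have "c 0 = 0"
    using sum_c c0 by (simp add: sum.atMost_Suc_shift del: sum.atMost_Suc)
  with c0 have "c i = 0"
    using Suc.prems(4) by (cases i) auto
  then show ?case
    using x0_ne by (simp add: c_def funpow_eq_0_iff)
qed

lemma dim_kernel_skew_poly_le:
  assumes "S \<subseteq> {x. skew_poly m a x = 0}" "i \<le> m" "a i \<noteq> 0"
  shows "dim S \<le> m"
proof (rule ccontr)
  assume "\<not> dim S \<le> m"
  moreover obtain B where B: "B \<subseteq> S" "independent B" "card B = dim S"
    by (rule basis_exists)
  ultimately have "m < card B" by simp
  moreover have "skew_poly m a x = 0" if "x \<in> B" for x
    using that B(1) assms(1) by auto
  ultimately have "a i = 0"
    using B(2) assms(2) by (auto intro: skew_poly_zero_coeffs[of B m a])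
  then show False
    using assms(3) by simp
qed

text \<open>
  Dedekind's independence of characters for the powers of \<open>\<sigma>\<close>: a nonzero operator of degree
  \<open>n - 1\<close> cannot kill a space of dimension \<open>n\<close>.
\<close>

lemma powers_independent:
  assumes "\<And>x. (\<Sum>i<ext_degree \<iota>. a i * (\<sigma> ^^ i) x) = 0" "i < ext_degree \<iota>"
  shows "a i = 0"
proof (rule ccontr)
  assume "a i \<noteq> 0"
  have "{..ext_degree \<iota> - 1} = {..<ext_degree \<iota>}"
    using degree_pos by auto
  then have "UNIV \<subseteq> {x. skew_poly (ext_degree \<iota> - 1) a x = 0}"
    using assms(1) by (simp add: skew_poly_def)
  then have "dim UNIV \<le> ext_degree \<iota> - 1"
    by (rule dim_kernel_skew_poly_le[of _ _ _ i]) (use assms \<open>a i \<noteq> 0\<close> in auto)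
  then show False
    using degree_pos unfolding degree_eq_dim by linarith
qed

section \<open>The order of the generator\<close>

text \<open>
  Converse to the kernel bound. If \<open>P\<close> annihilates \<open>B\<close> and \<open>z = P(x\<^sub>0)\<close>, then \<open>(\<sigma> - \<sigma>(z)/z) P\<close>
  annihilates \<open>x\<^sub>0\<close> as well, and it is again monic.
\<close>

lemma monic_annihilator:
  assumes "finite B"
  shows "\<exists>a. a (card B) = 1 \<and> (\<forall>x\<in>B. skew_poly (card B) a x = 0)"
  using assms
proof induction
  case empty
  show ?case by (rule exI[of _ "\<lambda>_. 1"]) simp
next
  case (insert x0 B)
  define m where "m = card B"
  obtain a where a: "a m = 1" "\<And>x. x \<in> B \<Longrightarrow> skew_poly m a x = 0"
    using insert by (auto simp: m_def)
  define z where "z = skew_poly m a x0"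
  \<comment> \<open>For \<open>z = 0\<close> this is \<open>0\<close>, and the new operator is \<open>\<sigma> P\<close>, which still kills \<open>x\<^sub>0\<close>.\<close>
  define c where "c = \<sigma> z / z"
  define b where "b i = (case i of 0 \<Rightarrow> 0 | Suc j \<Rightarrow> \<sigma> (a j)) - (if i \<le> m then c * a i else 0)" for i
  have sum_sigma: "\<sigma> (\<Sum>i\<in>I. g i) = (\<Sum>i\<in>I. \<sigma> (g i))" for I :: "nat set" and g
    by (induction I rule: infinite_finite_induct) (simp_all add: sigma_zero sigma_add)
  have "skew_poly (Suc m) b x = \<sigma> (skew_poly m a x) - c * skew_poly m a x" for x
  proof -
    have "skew_poly (Suc m) b x =
        (\<Sum>i\<le>Suc m. (case i of 0 \<Rightarrow> 0 | Suc j \<Rightarrow> \<sigma> (a j)) * (\<sigma> ^^ i) x)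
        - (\<Sum>i\<le>Suc m. (if i \<le> m then c * a i else 0) * (\<sigma> ^^ i) x)"
      by (simp add: skew_poly_def b_def left_diff_distrib sum_subtractf del: sum.atMost_Suc)
    also have "(\<Sum>i\<le>Suc m. (case i of 0 \<Rightarrow> 0 | Suc j \<Rightarrow> \<sigma> (a j)) * (\<sigma> ^^ i) x) = \<sigma> (skew_poly m a x)"
      by (simp add: sum.atMost_Suc_shift skew_poly_def sum_sigma sigma_mult del: sum.atMost_Suc)
    also have "(\<Sum>i\<le>Suc m. (if i \<le> m then c * a i else 0) * (\<sigma> ^^ i) x) = c * skew_poly m a x"
      by (simp add: skew_poly_def sum_distrib_left mult.assoc)
    finally show ?thesis .
  qed
  then have "skew_poly (Suc m) b x = 0" if "x \<in> insert x0 B" for x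
    using that a(2) by (auto simp: c_def z_def sigma_zero)
  moreover have "b (Suc m) = 1"
    using a(1) by (simp add: b_def sigma_one)
  ultimately show ?case
    using insert.hyps by (intro exI[of _ b]) (simp add: m_def)
qed

text \<open>
  Let \<open>P = \<Sum>\<^bsub>i\<le>n\<^esub> a\<^sub>i \<sigma>\<^sup>i\<close> be monic of degree \<open>n\<close> with \<open>P = 0\<close> on \<open>L\<close>. For fixed \<open>x\<close> the
  expression \<open>P(x y) - \<sigma>\<^sup>n(x) P(y)\<close> vanishes for all \<open>y\<close> and has degree below \<open>n\<close> as an operator
  in \<open>y\<close>, since the leading terms cancel. Hence all its coefficients \<open>a\<^sub>i (\<sigma>\<^sup>i(x) - \<sigma>\<^sup>n(x))\<close> are
  zero; the one at \<open>i = 0\<close> gives the claim, because \<open>a\<^sub>0 \<noteq> 0\<close>.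
\<close>

lemma funpow_degree: "(\<sigma> ^^ ext_degree \<iota>) x = x"
proof -
  let ?n = "ext_degree \<iota>" and ?B = "extend_basis {}"
  obtain a where a: "a ?n = 1" and B: "\<And>x. x \<in> ?B \<Longrightarrow> skew_poly ?n a x = 0"
    using monic_annihilator[OF finite_Basis] by (auto simp: degree_eq_dim)
  have kill: "skew_poly ?n a y = 0" for y
    using span_minimal[of ?B "{x. skew_poly ?n a x = 0}"] subspace_kernel_skew_poly B span_Basis
    by blast
  \<comment> \<open>Otherwise \<open>P = P' \<sigma>\<close> with \<open>P'\<close> monic of degree \<open>n - 1\<close> and zero on \<open>L\<close>.\<close>
  have a0: "a 0 \<noteq> 0"
  proof
    assume a0: "a 0 = 0"
    obtain m where m: "?n = Suc m"
      using degree_pos by (cases ?n) auto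
    have "(\<Sum>i<?n. a (Suc i) * (\<sigma> ^^ i) y) = 0" for y
    proof -
      obtain z where z: "y = \<sigma> z"
        using sigma_bij by (metis bij_pointE)
      have "(\<Sum>i<?n. a (Suc i) * (\<sigma> ^^ i) y) = skew_poly ?n a z"
        using a0 unfolding skew_poly_def m z
        by (simp add: sum.atMost_Suc_shift lessThan_Suc_atMost funpow_swap1
            del: sum.atMost_Suc)
      then show ?thesis by (simp add: kill)
    qed
    then have "a (Suc m) = 0"
      by (rule powers_independent[where a = "\<lambda>i. a (Suc i)"]) (simp add: m)
    then show False
      using a m by simp
  qed
  have "(\<Sum>i<?n. a i * ((\<sigma> ^^ i) x - (\<sigma> ^^ ?n) x) * (\<sigma> ^^ i) y) = 0" for y
  proof -
    have "(\<Sum>i<?n. a i * ((\<sigma> ^^ i) x - (\<sigma> ^^ ?n) x) * (\<sigma> ^^ i) y)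
        = (\<Sum>i\<le>?n. a i * ((\<sigma> ^^ i) x - (\<sigma> ^^ ?n) x) * (\<sigma> ^^ i) y)"
      by (rule sum.mono_neutral_left) (auto simp: not_less)
    also have "\<dots> = skew_poly ?n a (x * y) - (\<sigma> ^^ ?n) x * skew_poly ?n a y"
      unfolding skew_poly_def sum_distrib_left sum_subtractf[symmetric]
      by (rule sum.cong) (simp_all add: funpow_times algebra_simps)
    finally show ?thesis
      by (simp add: kill)
  qed
  then have "a 0 * ((\<sigma> ^^ 0) x - (\<sigma> ^^ ?n) x) = 0"
    by (rule powers_independent) (rule degree_pos)
  then show ?thesis
    using a0 by simp
qed

lemma carrier_eq_powers: "carrier (galois_group \<iota>) = (\<lambda>i. \<sigma> ^^ i) ` {..<ext_degree \<iota>}"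
proof
  let ?n = "ext_degree \<iota>"
  interpret G: group "galois_group \<iota>" by (rule group_galois_group)
  have funpow_mod: "\<sigma> ^^ (i mod ?n) = \<sigma> ^^ i" for i
    by (rule ext) (simp add: funpow_mod_eq funpow_degree)
  have "\<exists>i. \<theta> = \<sigma> ^^ i" if "\<theta> \<in> generate (galois_group \<iota>) {\<sigma>}" for \<theta>
    using that
  proof (induction rule: generate.induct)
    case one
    show ?case by (rule exI[of _ 0]) (simp add: galois_group_def)
  next
    case (incl h)
    then show ?case by (intro exI[of _ 1]) simp
  next
    case (inv h)
    have "\<sigma> ^^ (?n - 1) \<circ> \<sigma> = id"
    proof
      fix x
      have "(\<sigma> ^^ (?n - 1) \<circ> \<sigma>) x = (\<sigma> ^^ Suc (?n - 1)) x"
        by (simp add: funpow_swap1)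
      then show "(\<sigma> ^^ (?n - 1) \<circ> \<sigma>) x = id x"
        using degree_pos funpow_degree by simp
    qed
    then have "inv\<^bsub>galois_group \<iota>\<^esub> \<sigma> = \<sigma> ^^ (?n - 1)"
      using generator_in_group funpow_in_group[of "?n - 1"]
      by (intro G.inv_equality) (simp_all add: galois_group_def)
    with inv show ?case by auto
  next
    case (eng h1 h2)
    then obtain i j where "h1 = \<sigma> ^^ i" "h2 = \<sigma> ^^ j" by blast
    then show ?case
      by (intro exI[of _ "i + j"]) (simp add: galois_group_def Nat.funpow_add)
  qed
  then show "carrier (galois_group \<iota>) \<subseteq> (\<lambda>i. \<sigma> ^^ i) ` {..<?n}"
    using funpow_mod degree_pos unfolding group_generated
    by (metis (no_types, lifting) imageI lessThan_iff mod_less_divisor subsetI)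
qed (use funpow_in_group in auto)

lemma powers_distinct: "inj_on (\<lambda>i. \<sigma> ^^ i) {..<ext_degree \<iota>}"
proof (rule inj_onI, rule ccontr)
  let ?n = "ext_degree \<iota>"
  fix i j assume ij: "i \<in> {..<?n}" "j \<in> {..<?n}" "\<sigma> ^^ i = \<sigma> ^^ j" "i \<noteq> j"
  define a :: "nat \<Rightarrow> 'l" where "a l = (if l = i then 1 else 0) - (if l = j then 1 else 0)" for l
  have "(\<Sum>l<?n. a l * (\<sigma> ^^ l) x) = (\<sigma> ^^ i) x - (\<sigma> ^^ j) x" for x
  proof -
    have "(\<Sum>l<?n. a l * (\<sigma> ^^ l) x)
        = (\<Sum>l<?n. (if l = i then (\<sigma> ^^ l) x else 0)) - (\<Sum>l<?n. (if l = j then (\<sigma> ^^ l) x else 0))"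
      unfolding sum_subtractf[symmetric] by (rule sum.cong) (auto simp: a_def)
    then show ?thesis
      using ij by simp
  qed
  then have "a i = 0"
    using ij by (intro powers_independent[where a = a]) auto
  then show False
    using ij by (simp add: a_def)
qed

lemma emb_trace_eq_sum: "\<iota> (ext_trace \<iota> x) = (\<Sum>i<ext_degree \<iota>. (\<sigma> ^^ i) x)"
  by (simp add: emb_ext_trace carrier_eq_powers sum.reindex[OF powers_distinct])

section \<open>The trace and the skew-forms\<close>

lemma trace_add: "ext_trace \<iota> (x + y) = ext_trace \<iota> x + ext_trace \<iota> y"
  by (rule injD[OF inj_emb]) (simp add: emb_add emb_trace_eq_sum funpow_add sum.distrib)

lemma trace_scale: "ext_trace \<iota> (\<iota> c * x) = c * ext_trace \<iota> x"
  by (rule injD[OF inj_emb])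
    (simp add: emb_mult emb_trace_eq_sum funpow_times funpow_emb sum_distrib_left)

lemma trace_zero: "ext_trace \<iota> 0 = 0"
  using trace_scale[of 0 0] by (simp add: emb_zero)

lemma trace_diff: "ext_trace \<iota> (x - y) = ext_trace \<iota> x - ext_trace \<iota> y"
  using trace_add[of "x - y" y] by simp

lemma trace_sigma: "ext_trace \<iota> (\<sigma> x) = ext_trace \<iota> x"
proof (rule injD[OF inj_emb])
  have "(\<Sum>i<ext_degree \<iota>. (\<sigma> ^^ Suc i) x) + x = (\<Sum>i<ext_degree \<iota>. (\<sigma> ^^ i) x) + x"
    using sum.lessThan_Suc_shift[of "\<lambda>i. (\<sigma> ^^ i) x" "ext_degree \<iota>"]
      sum.lessThan_Suc[of "\<lambda>i. (\<sigma> ^^ i) x" "ext_degree \<iota>"]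
    by (simp add: funpow_degree add.commute del: funpow.simps)
  then show "\<iota> (ext_trace \<iota> (\<sigma> x)) = \<iota> (ext_trace \<iota> x)"
    by (simp add: emb_trace_eq_sum funpow_swap1)
qed

text \<open>
  \<open>y \<mapsto> Tr(x y)\<close> is the operator \<open>\<Sum>\<^bsub>i<n\<^esub> \<sigma>\<^sup>i(x) \<sigma>\<^sup>i\<close>, whose coefficient at \<open>i = 0\<close> is \<open>x\<close>.
\<close>

lemma trace_nondegenerate:
  assumes "\<And>y. ext_trace \<iota> (x * y) = 0"
  shows "x = 0"
proof -
  have "(\<Sum>i<ext_degree \<iota>. (\<sigma> ^^ i) x * (\<sigma> ^^ i) y) = 0" for y
    using emb_trace_eq_sum[of "x * y"] assms[of y] by (simp add: funpow_times emb_zero)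
  then have "(\<sigma> ^^ 0) x = 0"
    by (rule powers_independent) (rule degree_pos)
  then show ?thesis by simp
qed

text \<open>
  Applying \<open>\<sigma>\<close> inside the trace to the term \<open>b \<sigma>(x) y\<close> brings both terms to the form
  \<open>Tr(\<dots> \<sigma>(y))\<close>, from which the radical can be read off.
\<close>

lemma skew_form_eq_trace:
  "skew_form \<iota> b \<sigma> x y = ext_trace \<iota> ((b * x - \<sigma> b * \<sigma> (\<sigma> x)) * \<sigma> y)"
proof -
  have "skew_form \<iota> b \<sigma> x y = ext_trace \<iota> (b * x * \<sigma> y) - ext_trace \<iota> (b * \<sigma> x * y)"
    by (simp add: skew_form_def algebra_simps flip: trace_diff)
  also have "ext_trace \<iota> (b * \<sigma> x * y) = ext_trace \<iota> (\<sigma> b * \<sigma> (\<sigma> x) * \<sigma> y)"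
    using trace_sigma[of "b * \<sigma> x * y"] by (simp add: sigma_mult)
  finally show ?thesis
    by (simp add: left_diff_distrib flip: trace_diff)
qed

lemma radical_skew_form:
  "form_radical (skew_form \<iota> b \<sigma>) = {x. b * x = \<sigma> b * \<sigma> (\<sigma> x)}"
proof -
  have "b * x = \<sigma> b * \<sigma> (\<sigma> x)" if "\<And>y. skew_form \<iota> b \<sigma> x y = 0" for x
  proof -
    have "b * x - \<sigma> b * \<sigma> (\<sigma> x) = 0"
    proof (rule trace_nondegenerate)
      fix y
      obtain z where "y = \<sigma> z"
        using sigma_bij by (metis bij_pointE)
      then show "ext_trace \<iota> ((b * x - \<sigma> b * \<sigma> (\<sigma> x)) * y) = 0"
        using that[of z] by (simp add: skew_form_eq_trace)
    qed
    then show ?thesis by simp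
  qed
  then show ?thesis
    by (auto simp: form_radical_def skew_form_eq_trace trace_zero)
qed

lemma skew_form_in_Alt: "skew_form \<iota> b \<sigma> \<in> Alt \<iota>"
proof -
  have "Vector_Spaces.linear (ext_scale \<iota>) (*) (skew_form \<iota> b \<sigma> x)" for x
    by unfold_locales
      (auto simp: skew_form_def ext_scale_def sigma_add sigma_mult sigma_emb algebra_simps
         simp flip: trace_add trace_scale)
  moreover have "Vector_Spaces.linear (ext_scale \<iota>) (*) (\<lambda>x. skew_form \<iota> b \<sigma> x y)" for y
    by unfold_locales
      (auto simp: skew_form_def ext_scale_def sigma_add sigma_mult sigma_emb algebra_simps
         simp flip: trace_add trace_scale)
  moreover have "skew_form \<iota> b \<sigma> x x = 0" for x
    by (simp add: skew_form_def trace_zero mult.commute)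
  ultimately show ?thesis
    by (simp add: Alt_def)
qed

lemma linear_skew_form:
  "Vector_Spaces.linear (ext_scale \<iota>) form_scale (\<lambda>b. skew_form \<iota> b \<sigma>)"
proof -
  interpret F: vector_space "form_scale :: 'k \<Rightarrow> ('l \<Rightarrow> 'l \<Rightarrow> 'k) \<Rightarrow> _"
    by (rule vector_space_form_scale)
  show ?thesis
    by unfold_locales
      (auto simp: skew_form_def ext_scale_def form_scale_def fun_eq_iff distrib_right mult.assoc
         trace_add trace_scale)
qed

text \<open>
  The radical is the kernel of \<open>\<sigma>(b) \<sigma>\<^sup>2 - b\<close>, an operator of degree \<open>2\<close>.
\<close>

lemma dim_radical_le:
  assumes "b \<noteq> 0"
  shows "dim (form_radical (skew_form \<iota> b \<sigma>)) \<le> 2"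
proof (rule dim_kernel_skew_poly_le)
  let ?a = "\<lambda>i. if i = 0 then - b else if i = 1 then 0 else \<sigma> b"
  show "form_radical (skew_form \<iota> b \<sigma>) \<subseteq> {x. skew_poly 2 ?a x = 0}"
    by (auto simp: radical_skew_form skew_poly_def numeral_2_eq_2)
  show "?a 0 \<noteq> 0"
    using assms by simp
qed simp

section \<open>Eigenspaces of the involution in the Galois group\<close>

definition eigenspace :: "nat \<Rightarrow> 'l \<Rightarrow> 'l set" where
  "eigenspace k \<epsilon> = {b. (\<sigma> ^^ k) b = \<epsilon> * b}"

lemma subspace_eigenspace: "subspace (eigenspace k \<epsilon>)"
  by (rule subspaceI)
    (auto simp: eigenspace_def funpow_zero funpow_add funpow_times funpow_emb ext_scale_def
      algebra_simps)

lemma dim_eigenspace_le: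
  assumes "k \<ge> 1"
  shows "dim (eigenspace k \<epsilon>) \<le> k"
proof (rule dim_kernel_skew_poly_le)
  obtain m where m: "k = Suc m"
    using assms by (cases k) auto
  let ?a = "\<lambda>i. if i = 0 then - \<epsilon> else if i = k then 1 else 0"
  show "eigenspace k \<epsilon> \<subseteq> {x. skew_poly k ?a x = 0}"
  proof
    fix x assume x: "x \<in> eigenspace k \<epsilon>"
    have "skew_poly k ?a x = - \<epsilon> * x + (\<sigma> ^^ k) x"
      unfolding skew_poly_def m
      by (simp add: sum.atMost_Suc_shift if_distrib[of "\<lambda>c. c * _"] cong: if_cong
          del: sum.atMost_Suc funpow.simps)
    then show "x \<in> {x. skew_poly k ?a x = 0}"
      using x by (simp add: eigenspace_def)
  qed
  show "?a k \<noteq> 0"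
    using assms by simp
qed simp

end

locale cyclic_extension_even = cyclic_extension \<iota> \<sigma>
  for \<iota> :: "'k::field \<Rightarrow> 'l::field" and \<sigma> +
  fixes k :: nat
  assumes degree: "ext_degree \<iota> = 2 * k" and char_ne_2: "CHAR('k) \<noteq> 2"
begin

lemma k_pos: "k \<ge> 1"
  using degree degree_pos by simp

lemma funpow_two_k: "(\<sigma> ^^ (2 * k)) x = x"
  using funpow_degree degree by simp

lemma two_ne_0: "(2 :: 'l) \<noteq> 0"
proof
  assume "(2 :: 'l) = 0"
  then have "\<iota> (1 + 1) = \<iota> 0"
    using emb_add[of 1 1] by (simp add: emb_one emb_zero)
  then have "(1 + 1 :: 'k) = 0"
    using inj_emb by (blast dest: injD)
  then have "of_nat 2 = (0 :: 'k)"
    by simp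
  then have "CHAR('k) dvd 2"
    by (simp only: of_nat_eq_0_iff_char_dvd)
  then have "CHAR('k) \<le> 2"
    by (rule dvd_imp_le) simp
  moreover have "CHAR('k) \<noteq> 0"
  proof
    assume "CHAR('k) = 0"
    with \<open>CHAR('k) dvd 2\<close> have "0 dvd (2 :: nat)"
      by (simp only:)
    then show False by simp
  qed
  moreover have "CHAR('k) \<noteq> 1"
    using CHAR_not_1' by simp
  ultimately show False
    using char_ne_2 by simp
qed

lemma eigenspaces_sum: "{x + y | x y. x \<in> eigenspace k (- 1) \<and> y \<in> eigenspace k 1} = UNIV"
proof -
  have "\<exists>x y. b = x + y \<and> x \<in> eigenspace k (- 1) \<and> y \<in> eigenspace k 1" for b
  proof (intro exI conjI)
    have twice: "(\<sigma> ^^ k) ((\<sigma> ^^ k) b) = b"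
      using funpow_two_k by (simp add: funpow_comp mult_2)
    have fix2: "(\<sigma> ^^ k) 2 = 2"
      using funpow_add[of k 1 1] by (simp add: funpow_one)
    show "b = (b - (\<sigma> ^^ k) b) / 2 + (b + (\<sigma> ^^ k) b) / 2"
      using two_ne_0 by (simp add: add_divide_distrib[symmetric])
    show "(b - (\<sigma> ^^ k) b) / 2 \<in> eigenspace k (- 1)" "(b + (\<sigma> ^^ k) b) / 2 \<in> eigenspace k 1"
      using two_ne_0
      by (simp_all add: eigenspace_def funpow_divide funpow_diff funpow_add fix2 twice
          minus_divide_left add.commute)
  qed
  then show ?thesis by blast
qed

lemma eigenspaces_Int: "eigenspace k (- 1) \<inter> eigenspace k 1 = {0}"
proof (intro equalityI subsetI)
  fix b assume "b \<in> eigenspace k (- 1) \<inter> eigenspace k 1"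
  then show "b \<in> {0}"
    using two_ne_0 by (auto simp: eigenspace_def)
qed (simp add: eigenspace_def funpow_zero)

text \<open>
  The two eigenspaces span a space of dimension \<open>2 k\<close>, and neither exceeds dimension \<open>k\<close>.
\<close>

lemma dim_eigenspaces: "dim (eigenspace k (- 1)) = k" "dim (eigenspace k 1) = k"
proof -
  have "dim (UNIV :: 'l set) + dim {0} = dim (eigenspace k (- 1)) + dim (eigenspace k 1)"
    using dim_sums_Int[OF subspace_eigenspace[of k "- 1"] subspace_eigenspace[of k 1]]
    by (simp only: eigenspaces_sum eigenspaces_Int)
  moreover have "dim (UNIV :: 'l set) = 2 * k"
    using degree degree_eq_dim by simp
  moreover have "dim (eigenspace k (- 1)) \<le> k" "dim (eigenspace k 1) \<le> k"
    using k_pos by (rule dim_eigenspace_le)+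
  moreover have "dim {0 :: 'l} = 0"
    by simp
  ultimately show "dim (eigenspace k (- 1)) = k" "dim (eigenspace k 1) = k"
    by linarith+
qed

section \<open>The rank on each eigenspace\<close>

text \<open>
  For \<open>m = k\<close> this is the norm from \<open>L\<close> to the fixed field of \<open>\<sigma>\<^sup>2\<close>. Shorter products, with
  \<open>2 m = k + 1\<close>, provide elements of the radical.
\<close>

definition even_prod :: "nat \<Rightarrow> 'l \<Rightarrow> 'l" where
  "even_prod m b = (\<Prod>i<m. (\<sigma> ^^ (2 * i)) b)"

lemma even_prod_ne_0: "b \<noteq> 0 \<Longrightarrow> even_prod m b \<noteq> 0"
  by (simp add: even_prod_def funpow_eq_0_iff)

lemma even_prod_mult: "even_prod m (x * y) = even_prod m x * even_prod m y"
  by (simp add: even_prod_def funpow_times prod.distrib)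

lemma funpow_even_prod: "(\<sigma> ^^ j) (even_prod m b) = even_prod m ((\<sigma> ^^ j) b)"
proof -
  have "(\<sigma> ^^ j) (\<Prod>i<m. g i) = (\<Prod>i<m. (\<sigma> ^^ j) (g i))" for g
    by (induction m) (simp_all add: funpow_one funpow_times)
  then show ?thesis
    by (simp add: even_prod_def funpow_comp add.commute)
qed

lemmas sigma_even_prod = funpow_even_prod[of 1, simplified]

text \<open>
  Telescoping: moving the window of exponents by one step of \<open>\<sigma>\<^sup>2\<close> drops the factor \<open>b\<close> and adds
  \<open>\<sigma>\<^bsup>2m\<^esup>(b)\<close>. The factor \<open>b\<close> stays on the left, so that the identity holds for \<open>b = 0\<close> too.
\<close>

lemma even_prod_shift: "even_prod m (\<sigma> (\<sigma> b)) * b = even_prod m b * (\<sigma> ^^ (2 * m)) b"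
proof (induction m)
  case (Suc m)
  have "even_prod (Suc m) (\<sigma> (\<sigma> b)) * b
      = even_prod m (\<sigma> (\<sigma> b)) * b * (\<sigma> ^^ (2 * m)) (\<sigma> (\<sigma> b))"
    by (simp add: even_prod_def)
  also have "\<dots> = even_prod (Suc m) b * (\<sigma> ^^ (2 * Suc m)) b"
    by (simp only: Suc.IH) (simp add: even_prod_def funpow_swap1)
  finally show ?case .
qed (simp add: even_prod_def)

lemma norm_fixed_by_square:
  assumes "b \<noteq> 0"
  shows "even_prod k (\<sigma> (\<sigma> b)) = even_prod k b"
  using even_prod_shift[of k b] assms by (simp add: funpow_two_k)

end

locale cyclic_extension_twice_odd = cyclic_extension_even \<iota> \<sigma> k
  for \<iota> :: "'k::field \<Rightarrow> 'l::field" and \<sigma> k +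
  assumes odd_k: "odd k"
begin

text \<open>
  If \<open>\<sigma>\<close> fixed the norm \<open>N(b)\<close>, so would \<open>\<sigma>\<^sup>k\<close>; but \<open>\<sigma>\<^sup>k(N(b)) = N(- b) = - N(b)\<close> for odd \<open>k\<close>.
\<close>

lemma norm_minus_eigenspace:
  assumes "b \<in> eigenspace k (- 1)" "b \<noteq> 0"
  shows "even_prod k (\<sigma> b) \<noteq> even_prod k b"
proof
  assume eq: "even_prod k (\<sigma> b) = even_prod k b"
  have s: "\<sigma> (even_prod k b) = even_prod k b"
    using eq by (simp add: sigma_even_prod)
  have "(\<sigma> ^^ j) (even_prod k b) = even_prod k b" for j
    by (induction j) (simp_all add: s)
  then have "even_prod k (- b) = even_prod k b"
    using funpow_even_prod[of k k b] assms(1) by (simp add: eigenspace_def)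
  moreover have "even_prod k (- b) = - even_prod k b"
    using odd_k even_prod_mult[of k "- 1" b]
    by (simp add: even_prod_def funpow_minus funpow_one)
  ultimately have "2 * even_prod k b = 0"
    by (metis add.right_inverse mult_2)
  then show False
    using two_ne_0 even_prod_ne_0[OF assms(2)] by simp
qed

text \<open>
  Taking norms in \<open>b x = \<sigma>(b) \<sigma>\<^sup>2(x)\<close> cancels \<open>x\<close>, since \<open>N(\<sigma>\<^sup>2(x)) = N(x)\<close>, and leaves
  \<open>N(b) = \<sigma>(N(b))\<close>.
\<close>

lemma radical_minus_eigenspace:
  assumes "b \<in> eigenspace k (- 1)" "b \<noteq> 0"
  shows "form_radical (skew_form \<iota> b \<sigma>) = {0}"
proof -
  have "x = 0" if x: "b * x = \<sigma> b * \<sigma> (\<sigma> x)" for x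
  proof (rule ccontr)
    assume "x \<noteq> 0"
    have "even_prod k b * even_prod k x = even_prod k (\<sigma> b) * even_prod k (\<sigma> (\<sigma> x))"
      using x by (metis even_prod_mult)
    then have "even_prod k b = even_prod k (\<sigma> b)"
      using norm_fixed_by_square[OF \<open>x \<noteq> 0\<close>] even_prod_ne_0[OF \<open>x \<noteq> 0\<close>] by simp
    then show False
      using norm_minus_eigenspace[OF assms] by simp
  qed
  then show ?thesis
    by (auto simp: radical_skew_form sigma_zero)
qed

text \<open>
  The fixed field of \<open>\<sigma>\<^sup>2\<close> is strictly larger than \<open>K\<close>: the norm of any nonzero element of the
  eigenspace for \<open>- 1\<close> witnesses this.
\<close>

lemma square_fixed_not_fixed: "\<exists>w. \<sigma> (\<sigma> w) = w \<and> \<sigma> w \<noteq> w"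
proof -
  have "\<not> eigenspace k (- 1) \<subseteq> {0}"
    using dim_eigenspaces(1) k_pos dim_eq_0[of "eigenspace k (- 1)"] by auto
  then obtain d where d: "d \<in> eigenspace k (- 1)" "d \<noteq> 0" by blast
  have "\<sigma> (\<sigma> (even_prod k d)) = even_prod k d" "\<sigma> (even_prod k d) \<noteq> even_prod k d"
    using norm_minus_eigenspace[OF d] norm_fixed_by_square[OF d(2)]
    by (simp_all add: sigma_even_prod)
  then show ?thesis by blast
qed

text \<open>
  The radical contains the inverse \<open>y\<close> of an even product, and with it \<open>y w\<close> for every \<open>w\<close>
  fixed by \<open>\<sigma>\<^sup>2\<close>; choosing \<open>w\<close> outside \<open>K\<close> gives a second independent element.
\<close>

lemma dim_radical_plus_eigenspace:
  assumes "b \<in> eigenspace k 1" "b \<noteq> 0"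
  shows "dim (form_radical (skew_form \<iota> b \<sigma>)) = 2"
proof (rule antisym)
  show "dim (form_radical (skew_form \<iota> b \<sigma>)) \<le> 2"
    using assms(2) by (rule dim_radical_le)
  obtain m where m: "Suc k = 2 * m"
    using odd_k by (metis even_Suc evenE)
  define y where "y = 1 / even_prod m b"
  have ne: "even_prod m b \<noteq> 0" "even_prod m (\<sigma> (\<sigma> b)) \<noteq> 0"
    using assms(2) by (simp_all add: even_prod_ne_0 sigma_eq_0_iff)
  then have "y \<noteq> 0" by (simp add: y_def)
  have "(\<sigma> ^^ (2 * m)) b = \<sigma> b"
    using assms(1) by (simp add: eigenspace_def flip: m)
  then have shift: "even_prod m (\<sigma> (\<sigma> b)) * b = even_prod m b * \<sigma> b"
    using even_prod_shift[of m b] by simp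
  have sigma_y: "\<sigma> (\<sigma> y) = 1 / even_prod m (\<sigma> (\<sigma> b))"
    by (simp add: y_def sigma_divide sigma_one sigma_even_prod)
  then have y: "b * y = \<sigma> b * \<sigma> (\<sigma> y)"
    using ne shift unfolding sigma_y unfolding y_def by (simp add: frac_eq_eq ac_simps)
  obtain w where w: "\<sigma> (\<sigma> w) = w" "\<sigma> w \<noteq> w"
    using square_fixed_not_fixed by blast
  have notin: "y * w \<notin> span {y}"
  proof
    assume "y * w \<in> span {y}"
    then obtain c where "y * w = \<iota> c * y"
      by (auto simp: span_singleton ext_scale_def)
    then have "w = \<iota> c"
      using \<open>y \<noteq> 0\<close> by simp
    then show False
      using w(2) by (simp add: sigma_emb)
  qed
  then have "independent {y * w, y}"
    using \<open>y \<noteq> 0\<close> by (intro independent_insertI) (auto simp: independent_empty)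
  moreover have "{y * w, y} \<subseteq> form_radical (skew_form \<iota> b \<sigma>)"
    using y w by (auto simp: radical_skew_form sigma_mult simp flip: mult.assoc)
  ultimately have "card {y * w, y} \<le> dim (form_radical (skew_form \<iota> b \<sigma>))"
    by (rule independent_card_le_dim[rotated])
  moreover have "y * w \<noteq> y"
    using notin span_base[of y "{y}"] by auto
  ultimately show "2 \<le> dim (form_radical (skew_form \<iota> b \<sigma>))"
    by simp
qed

text \<open>
  The rank also settles everything else: a nonzero \<open>b\<close> with \<open>f\<^sub>b\<close> of positive rank is not in the
  kernel of \<open>b \<mapsto> f\<^sub>b\<close>, so dimensions carry over from the eigenspaces, and a nonzero form cannot have
  both ranks \<open>2 k\<close> and \<open>2 k - 2\<close>, so the sum is direct. For \<open>k = 1\<close> the rank \<open>2 k - 2\<close> is \<open>0\<close> and the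
  second space collapses to \<open>{0}\<close>, which is why its dimension is stated for \<open>k > 1\<close> only.
\<close>

lemma skew_space_decomposition:
  "\<exists>U V. r_subspace \<iota> (2 * k) U \<and> vector_space.dim form_scale U = k \<and>
     r_subspace \<iota> (2 * k - 2) V \<and> (k > 1 \<longrightarrow> vector_space.dim form_scale V = k) \<and>
     skew_space \<iota> \<sigma> = {u + v | u v. u \<in> U \<and> v \<in> V} \<and> U \<inter> V = {0}"
proof -
  interpret F: vector_space "form_scale :: 'k \<Rightarrow> ('l \<Rightarrow> 'l \<Rightarrow> 'k) \<Rightarrow> _"
    by (rule vector_space_form_scale)
  interpret P: finite_dimensional_vector_space_pair_1 "ext_scale \<iota>" "extend_basis {}"
    "form_scale :: 'k \<Rightarrow> ('l \<Rightarrow> 'l \<Rightarrow> 'k) \<Rightarrow> _"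
    by unfold_locales
  define f where "f b = skew_form \<iota> b \<sigma>" for b
  have lin: "Vector_Spaces.linear (ext_scale \<iota>) form_scale f"
    unfolding f_def by (rule linear_skew_form)
  interpret f: Vector_Spaces.linear "ext_scale \<iota>" form_scale f by (rule lin)
  define U where "U = f ` eigenspace k (- 1)"
  define V where "V = f ` eigenspace k 1"
  have rank_U: "form_rank \<iota> (f b) = 2 * k" if "b \<in> eigenspace k (- 1)" "b \<noteq> 0" for b
    using that by (simp add: f_def form_rank_def radical_minus_eigenspace degree)
  have rank_V: "form_rank \<iota> (f b) = 2 * k - 2" if "b \<in> eigenspace k 1" "b \<noteq> 0" for b
    using that by (simp add: f_def form_rank_def dim_radical_plus_eigenspace degree)
  have rank_zero: "form_rank \<iota> (0 :: 'l \<Rightarrow> 'l \<Rightarrow> 'k) = 0"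
    by (simp add: form_rank_def form_radical_def degree_eq_dim)
  have r_subspace_image: "r_subspace \<iota> r (f ` eigenspace k \<epsilon>)"
    if rank: "\<And>b. b \<in> eigenspace k \<epsilon> \<Longrightarrow> b \<noteq> 0 \<Longrightarrow> form_rank \<iota> (f b) = r" for r \<epsilon>
  proof -
    have "f ` eigenspace k \<epsilon> \<subseteq> Alt \<iota>"
      using skew_form_in_Alt by (auto simp: f_def)
    moreover have "form_rank \<iota> (f b) = r" if "b \<in> eigenspace k \<epsilon>" "f b \<noteq> 0" for b
    proof (rule rank[OF that(1)])
      show "b \<noteq> 0"
      proof
        assume "b = 0"
        with that(2) show False
          by (simp only: f.zero not_True_eq_False simp_thms)
      qed
    qed
    ultimately show ?thesis
      using f.subspace_image[OF subspace_eigenspace] by (auto simp: r_subspace_def)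
  qed
  have dim_image: "F.dim (f ` eigenspace k \<epsilon>) = dim (eigenspace k \<epsilon>)"
    if rank: "\<And>b. b \<in> eigenspace k \<epsilon> \<Longrightarrow> b \<noteq> 0 \<Longrightarrow> form_rank \<iota> (f b) = r" and "r > 0"
    for r \<epsilon>
  proof (rule P.dim_image_eq[OF lin])
    have "x = 0" if "x \<in> eigenspace k \<epsilon>" "f x = 0" for x
      using rank[OF that(1)] that(2) \<open>r > 0\<close> rank_zero by auto
    then show "inj_on f (span (eigenspace k \<epsilon>))"
      by (simp only: span_eq_iff[THEN iffD2, OF subspace_eigenspace]
          f.inj_on_iff_eq_0[OF subspace_eigenspace]) blast
  qed
  have U: "r_subspace \<iota> (2 * k) U"
    unfolding U_def by (rule r_subspace_image) (rule rank_U)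
  moreover have V: "r_subspace \<iota> (2 * k - 2) V"
    unfolding V_def by (rule r_subspace_image) (rule rank_V)
  moreover have "F.dim U = k"
    using dim_image[OF rank_U] k_pos dim_eigenspaces by (simp add: U_def)
  moreover have "F.dim V = k" if "k > 1"
    using dim_image[OF rank_V] that dim_eigenspaces by (simp add: V_def)
  moreover have "skew_space \<iota> \<sigma> = {u + v | u v. u \<in> U \<and> v \<in> V}"
  proof -
    have "skew_space \<iota> \<sigma> = f ` {x + y | x y. x \<in> eigenspace k (- 1) \<and> y \<in> eigenspace k 1}"
      unfolding eigenspaces_sum by (simp add: skew_space_def f_def)
    also have "\<dots> = {f (x + y) | x y. x \<in> eigenspace k (- 1) \<and> y \<in> eigenspace k 1}"
      by blast
    also have "\<dots> = {u + v | u v. u \<in> U \<and> v \<in> V}"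
      unfolding f.add U_def V_def by blast
    finally show ?thesis .
  qed
  moreover have "U \<inter> V = {0}"
  proof -
    have "0 \<in> U \<inter> V"
      using U V F.subspace_0 by (auto simp: r_subspace_def)
    moreover have "g = 0" if "g \<in> U" "g \<in> V" for g
    proof (rule ccontr)
      assume "g \<noteq> 0"
      then have "form_rank \<iota> g = 2 * k" "form_rank \<iota> g = 2 * k - 2"
        using U V that by (auto simp: r_subspace_def)
      then show False
        using k_pos by simp
    qed
    ultimately show ?thesis by blast
  qed
  ultimately show ?thesis by blast
qed

end

theorem theoremA:
  fixes \<iota> :: "'k::field \<Rightarrow> 'l::field" and \<sigma> :: "'l \<Rightarrow> 'l" and n k :: nat
  assumes char: "CHAR('k) \<noteq> 2"
    and n: "n = 2 * k" and k: "k \<ge> 1" "odd k"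
    and ext: "finite_galois_extension \<iota>" "ext_degree \<iota> = n"
    and cyclic: "\<sigma> \<in> carrier (galois_group \<iota>)"
      "carrier (galois_group \<iota>) = generate (galois_group \<iota>) {\<sigma>}"
  shows "\<exists>U V. r_subspace \<iota> n U \<and> vector_space.dim form_scale U = k \<and>
           r_subspace \<iota> (n - 2) V \<and> (k > 1 \<longrightarrow> vector_space.dim form_scale V = k) \<and>
           skew_space \<iota> \<sigma> = {u + v | u v. u \<in> U \<and> v \<in> V} \<and> U \<inter> V = {0}"
proof -
  interpret finite_galois_extension \<iota> by (rule ext)
  interpret cyclic_extension_twice_odd \<iota> \<sigma> k
    by unfold_locales (use assms in auto)
  show ?thesis
    using skew_space_decomposition by (simp add: n)
qed

end
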